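(* Let $T$ be a lower bound tree for the radio number (i.e. $T \in \mathcal{T}_{lb}$) of order $n_0$ and diameter $d_0$ with exactly one weight center $w_0$, and let $k \geq 2$ be an integer. Let $D_k$ be the $k$-double star, i.e. the tree formed from $K_2$ by attaching $k$ pendant edges (hence $k$ leaves) to each of its two vertices. Let $T_{D_k}$ be the tree obtained from $D_k$ by taking $2k$ disjoint copies of $T$, one for each leaf of $D_k$, and identifying the weight center $w_0$ of each copy with the corresponding leaf. Let $d = \mathrm{diam}(T_{D_k})$. Then $T_{D_k} \in \mathcal{T}_{lb}$ and $$\mathrm{rn}(T_{D_k}) = 2k\bigl(\mathrm{rn}(T) + n_0(d - d_0 - 3) + d_0\bigr) + d.$$
   Context: All graphs are finite, simple and connected. $d_G(u,v)$ denotes graph distance and $\mathrm{diam}(G)$ the diameter. A radio labeling of a graph $G$ is a map $f : V(G) \to \{0,1,2,\ldots\}$ such that $|f(u)-f(v)| \geq \mathrm{diam}(G) + 1 - d_G(u,v)$ for every pair of distinct vertices $u,v$. Its span is $\max\{f(v) : v \in V(G)\}$. The radio number $\mathrm{rn}(G)$ is the minimum span over all radio labelings of $G$. For a tree $T$ and $v \in V(T)$, put $w_T(v) = \sum_{u \in V(T)} d_T(u,v)$. A weight center of $T$ is a vertex minimizing $w_T$; $W(T)$ denotes the set of weight centers, and it consists of either one vertex or two adjacent vertices. Put $\varepsilon(T) = 1$ if $|W(T)| = 1$ and $\varepsilon(T) = 0$ if $|W(T)| = 2$. The level of $u \in V(T)$ is $L_T(u) = \min\{d_T(u,x) : x \in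 W(T)\}$ and the total level of $T$ is $L(T) = \sum_{u \in V(T)} L_T(u)$. For a tree $T$ of order $n$ and diameter $d \geq 2$, define $lb(T) = (n-1)(d + \varepsilon(T)) - 2L(T) + \varepsilon(T)$ (this is a known lower bound for $\mathrm{rn}(T)$). $T$ is called a lower bound tree if $\mathrm{rn}(T) = lb(T)$; $\mathcal{T}_{lb}$ denotes the set of all lower bound trees (of diameter at least 2). *)

theory Defs
  imports "Graph_Theory.Pair_Digraph" "Graph_Theory.Digraph_Component"
begin

text \<open>
  Finite simple graphs are values \<open>G\<close> with \<open>pair_graph G\<close>: a finite vertex set and a
  finite, symmetric, loop-free arc relation. An undirected edge is thus the pair of arcs
  \<open>(u, v)\<close>, \<open>(v, u)\<close>.
\<close>

text \<open>
  The library predicate \<open>tree\<close> is of no use for symmetric digraphs, since there the arc list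
  \<open>[(u, v), (v, u)]\<close> is already a cycle. The cycles of the undirected graph are the
  library cycles of length at least 3.
\<close>

definition utree :: "'a pair_pre_digraph \<Rightarrow> bool" where
  "utree G \<longleftrightarrow> pair_graph G \<and> Digraph_Component.connected (with_proj G) \<and>
     \<not> (\<exists>p. pre_digraph.cycle (with_proj G) p \<and> 3 \<le> length p)"

definition gdist :: "'a pair_pre_digraph \<Rightarrow> 'a \<Rightarrow> 'a \<Rightarrow> nat" where
  "gdist G u v = (LEAST n. \<exists>p. pre_digraph.awalk (with_proj G) u p v \<and> length p = n)"

definition gdiam :: "'a pair_pre_digraph \<Rightarrow> nat" where
  "gdiam G = Max {gdist G u v | u v. u \<in> pverts G \<and> v \<in> pverts G}"

text \<open>Only the values of a labeling on \<open>pverts G\<close> matter.\<close>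

definition radio_labeling :: "'a pair_pre_digraph \<Rightarrow> ('a \<Rightarrow> nat) \<Rightarrow> bool" where
  "radio_labeling G f \<longleftrightarrow>
     (\<forall>u\<in>pverts G. \<forall>v\<in>pverts G. u \<noteq> v \<longrightarrow>
        \<bar>int (f u) - int (f v)\<bar> \<ge> int (gdiam G) + 1 - int (gdist G u v))"

definition label_span :: "'a pair_pre_digraph \<Rightarrow> ('a \<Rightarrow> nat) \<Rightarrow> nat" where
  "label_span G f = Max (f ` pverts G)"

definition radio_number :: "'a pair_pre_digraph \<Rightarrow> nat" where
  "radio_number G = (LEAST s. \<exists>f. radio_labeling G f \<and> label_span G f = s)"

definition weight :: "'a pair_pre_digraph \<Rightarrow> 'a \<Rightarrow> nat" where
  "weight T v = (\<Sum>u\<in>pverts T. gdist T u v)"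

definition weight_centers :: "'a pair_pre_digraph \<Rightarrow> 'a set" where
  "weight_centers T = {v \<in> pverts T. \<forall>x\<in>pverts T. weight T v \<le> weight T x}"

text \<open>A tree has either one or two weight centers, so the second branch means two.\<close>

definition center_eps :: "'a pair_pre_digraph \<Rightarrow> nat" where
  "center_eps T = (if card (weight_centers T) = 1 then 1 else 0)"

definition level :: "'a pair_pre_digraph \<Rightarrow> 'a \<Rightarrow> nat" where
  "level T u = Min {gdist T u x | x. x \<in> weight_centers T}"

definition total_level :: "'a pair_pre_digraph \<Rightarrow> nat" where
  "total_level T = (\<Sum>u\<in>pverts T. level T u)"

definition lb :: "'a pair_pre_digraph \<Rightarrow> int" where
  "lb T = (int (card (pverts T)) - 1) * (int (gdiam T) + int (center_eps T))
            - 2 * int (total_level T) + int (center_eps T)"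

definition lower_bound_tree :: "'a pair_pre_digraph \<Rightarrow> bool" where
  "lower_bound_tree T \<longleftrightarrow> utree T \<and> 2 \<le> gdiam T \<and> int (radio_number T) = lb T"

datatype dstar_vertex = Hub bool | Pendant bool nat

definition double_star :: "nat \<Rightarrow> dstar_vertex pair_pre_digraph" where
  "double_star k =
     (let E = {(Hub False, Hub True)} \<union> {(Hub b, Pendant b i) | b i. i < k}
      in \<lparr> pverts = range Hub \<union> {Pendant b i | b i. i < k}, parcs = E \<union> E\<inverse> \<rparr>)"

definition leaves :: "'a pair_pre_digraph \<Rightarrow> 'a set" where
  "leaves G = {v \<in> pverts G. out_degree (with_proj G) v = 1}"

text \<open>
  Attaching a copy of \<open>T\<close> at every leaf of \<open>D\<close>, the vertex \<open>w\<close> of the copy being identified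
  with the leaf. The vertex \<open>v\<close> of the copy at leaf \<open>l\<close> is \<open>Inr (l, v)\<close>, a non-leaf \<open>x\<close> of
  \<open>D\<close> is \<open>Inl x\<close>, and the class formed by a leaf \<open>l\<close> and the vertex \<open>w\<close> of its copy is
  represented by \<open>Inr (l, w)\<close>; \<open>leaf_embed\<close> is the resulting embedding of \<open>D\<close>.
\<close>

definition leaf_embed ::
    "'b pair_pre_digraph \<Rightarrow> 'a \<Rightarrow> 'b \<Rightarrow> 'b + 'b \<times> 'a" where
  "leaf_embed D w x = (if x \<in> leaves D then Inr (x, w) else Inl x)"

definition attach_at_leaves ::
    "'b pair_pre_digraph \<Rightarrow> 'a pair_pre_digraph \<Rightarrow> 'a \<Rightarrow> ('b + 'b \<times> 'a) pair_pre_digraph" where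
  "attach_at_leaves D T w =
     \<lparr> pverts = leaf_embed D w ` pverts D \<union> {Inr (l, v) | l v. l \<in> leaves D \<and> v \<in> pverts T},
       parcs = {(leaf_embed D w x, leaf_embed D w y) | x y. (x, y) \<in> parcs D} \<union>
               {(Inr (l, u), Inr (l, v)) | l u v. l \<in> leaves D \<and> (u, v) \<in> parcs T} \<rparr>"

end

theory Submission
  imports Defs
begin

text \<open>
  Root \<open>T\<close> at its weight center \<open>w\<close> and let \<open>h\<close> be its height. In \<open>TD\<close> the weight centers are the
  two hubs, the diameter is \<open>2 h + 3\<close>, and \<open>dist x y \<le> level x + level y + 1\<close>. Along the vertices
  sorted by label, consecutive labels of a radio labeling therefore differ by at least
  \<open>d - level x - level y\<close>, which gives \<open>lb TD \<le> rn TD\<close>.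

  For the converse take an optimal labeling \<open>F\<close> of \<open>T\<close>. Label one hub first and the other last;
  in between run through the vertices of \<open>T\<close> in the order of \<open>F\<close>, visiting for each of them its
  \<open>2 k\<close> copies, alternating between the two sides of the double star. The gap between two successive
  copies of \<open>v\<close> is \<open>2 h + 1 - 2 ht v > 0\<close>, and from the last copy of \<open>u\<close> to the first copy
  of its successor \<open>v\<close> the label grows by \<open>F v - F u + 2 h - diam T\<close>. The radio conditions follow
  from those of \<open>F\<close>, and the last label is at most \<open>lb TD\<close> because \<open>F\<close> has span \<open>lb T\<close>.
\<close>

section \<open>Distances and cycles\<close>

lemma gdist_le_length:
  assumes "pre_digraph.awalk (with_proj G) u p v"
  shows "gdist G u v \<le> length p"
  unfolding gdist_def using assms by (intro Least_le) blast

lemma ex_awalk_length_gdist: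
  assumes "pre_digraph.awalk (with_proj G) u p v"
  shows "\<exists>q. pre_digraph.awalk (with_proj G) u q v \<and> length q = gdist G u v"
  unfolding gdist_def by (rule LeastI_ex) (use assms in blast)

section \<open>Distances from potentials, and cycles as periodic sequences\<close>

context pair_wf_digraph
begin

text \<open>A potential that drops by at most 1 along arcs bounds the length of every walk to
  \<open>v\<close> from below; following arcs where it drops by exactly 1 gives a walk that attains
  the bound. This lets a closed formula be recognised as the distance.\<close>

lemma
  assumes v: "v \<in> pverts G" "\<delta> v = 0"
    and le: "\<And>x y. (x, y) \<in> parcs G \<Longrightarrow> \<delta> x \<le> \<delta> y + 1"
    and step: "\<And>x. x \<in> pverts G \<Longrightarrow> x \<noteq> v \<Longrightarrow> \<exists>y. (x, y) \<in> parcs G \<and> \<delta> x = \<delta> y + 1"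
    and u: "u \<in> pverts G"
  shows gdist_eqI: "gdist G u v = \<delta> u"
    and ex_awalkI: "\<exists>p. awalk u p v"
proof -
  have lower: "\<delta> x \<le> length p" if "awalk x p v" for x p
    using that
  proof (induction p arbitrary: x)
    case Nil
    then show ?case using v by (simp add: awalk_Nil_iff)
  next
    case (Cons e p)
    then have "awalk (snd e) p v" "(x, snd e) \<in> parcs G"
      by (auto simp: awalk_Cons_iff)
    then show ?case using Cons.IH[of "snd e"] le[of x "snd e"] by simp
  qed
  have upper: "\<exists>p. awalk x p v \<and> length p = n" if "x \<in> pverts G" "\<delta> x = n" for x n
    using that
  proof (induction n arbitrary: x rule: less_induct)
    case (less n)
    show ?case
    proof (cases "x = v")
      case True
      then have "awalk x [] v \<and> length [] = n" using less.prems v by (simp add: awalk_Nil_iff)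
      then show ?thesis by blast
    next
      case False
      then obtain y where y: "(x, y) \<in> parcs G" "\<delta> x = \<delta> y + 1"
        using step less.prems by blast
      then obtain p where "awalk y p v" "length p = \<delta> y"
        using less.IH[of "\<delta> y" y] less.prems wellformed'(2) by auto
      then have "awalk x ((x, y) # p) v \<and> length ((x, y) # p) = n"
        using y less.prems by (simp add: awalk_Cons_iff)
      then show ?thesis by blast
    qed
  qed
  obtain p where p: "awalk u p v" "length p = \<delta> u" using upper[OF u refl] by blast
  then show "\<exists>p. awalk u p v" by blast
  obtain q where "awalk u q v" "length q = gdist G u v"
    using ex_awalk_length_gdist[OF p(1)] by blast
  then show "gdist G u v = \<delta> u"
    using lower[of u q] gdist_le_length[OF p(1)] p(2) by simp
qed

text \<open>Indexing over all of nat with period \<open>length p\<close> removes the special role of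
  the start vertex and of the closing arc, so a cycle can be followed from any index past any
  bound.\<close>

lemma cyclic_sequence_of_cycle:
  assumes "cycle p"
  obtains c :: "nat \<Rightarrow> 'a"
  where "\<And>i. c (i + length p) = c i" "\<And>i. (c i, c (Suc i)) \<in> parcs G" "inj_on c {..<length p}"
proof -
  from assms obtain u where u: "awalk u p u" "distinct (tl (pawalk_verts u p))" "p \<noteq> []"
    unfolding cycle_def by auto
  have pcas: "pcas u p u" and arcs: "set p \<subseteq> parcs G" using u(1) by (auto simp: awalk_def)
  have nth: "fst (p ! 0) = a \<and> snd (last p) = b \<and> (\<forall>i. Suc i < length p \<longrightarrow> snd (p ! i) = fst (p ! Suc i))"
    if "pcas a p b" "p \<noteq> []" for p and a b :: 'a
    using that
  proof (induction p arbitrary: a)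
    case (Cons e p)
    show ?case
    proof (cases "p = []")
      case False
      with Cons show ?thesis by (auto simp: nth_Cons split: nat.splits)
    qed (use Cons in auto)
  qed simp
  define n where "n = length p"
  have n: "0 < n" using u(3) by (simp add: n_def)
  define c where "c i = fst (p ! (i mod n))" for i
  have suc: "c (Suc i) = snd (p ! (i mod n))" for i
  proof (cases "Suc (i mod n) = n")
    case True
    then have "Suc i mod n = 0" by (simp add: mod_Suc)
    then have "c (Suc i) = u" using nth[OF pcas u(3)] by (simp add: c_def)
    moreover have "i mod n = n - 1" using True by simp
    then have "last p = p ! (i mod n)" using u(3) by (simp add: last_conv_nth n_def)
    ultimately show ?thesis using nth[OF pcas u(3)] by simp
  next
    case False
    moreover have "i mod n < n" using n by simp
    ultimately have "Suc i mod n = Suc (i mod n)" "Suc (i mod n) < length p"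
      by (auto simp: mod_Suc n_def)
    then show ?thesis using nth[OF pcas u(3)] by (simp add: c_def)
  qed
  \<comment> \<open>\<open>cycle\<close> speaks of the vertex list without its first entry, that is,
    of the heads of the arcs. The tails \<open>c i\<close> are these heads shifted by one
    place.\<close>
  have "distinct (map snd p)"
    using u(2) awalk_verts_conv'[of u p u] pcas u(3) by simp
  then have inj_Suc: "i = j" if "snd (p ! i) = snd (p ! j)" "i < n" "j < n" for i j
    using that by (simp add: distinct_conv_nth n_def) (metis nth_map)
  have "inj_on c {..<n}"
  proof (rule inj_onI)
    fix i j assume ij: "i \<in> {..<n}" "j \<in> {..<n}" "c i = c j"
    \<comment> \<open>Adding \<open>n - 1\<close> is stepping back by one modulo \<open>n\<close>,
      which also works at index 0.\<close>
    have "c (Suc (i + (n - 1))) = c i" for i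
      using n by (simp add: c_def)
    then have "snd (p ! ((i + (n - 1)) mod n)) = snd (p ! ((j + (n - 1)) mod n))"
      using ij(3) suc by metis
    then have "(i + (n - 1)) mod n = (j + (n - 1)) mod n"
      using inj_Suc n by simp
    then have "(i + (n - 1) + 1) mod n = (j + (n - 1) + 1) mod n"
      by (metis mod_add_left_eq)
    then show "i = j" using ij n by simp
  qed
  moreover have "(c i, c (Suc i)) \<in> parcs G" for i
  proof -
    have "p ! (i mod n) \<in> parcs G" using arcs n by (auto simp: n_def)
    then show ?thesis by (simp add: suc) (simp add: c_def)
  qed
  moreover have "c (i + n) = c i" for i by (simp add: c_def)
  ultimately show thesis using that[of c] unfolding n_def by blast
qed

lemma cycle_of_cyclic_sequence:
  fixes c :: "nat \<Rightarrow> 'a"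
  assumes per: "c n = c 0" and arcs: "\<And>i. (c i, c (Suc i)) \<in> parcs G"
    and inj: "inj_on c {..<n}" and n: "0 < n"
  shows "\<exists>p. cycle p \<and> length p = n"
proof -
  define p where "p = map (\<lambda>i. (c i, c (Suc i))) [0..<n]"
  have "awalk (c 0) (map (\<lambda>i. (c i, c (Suc i))) [0..<m]) (c m)" for m
  proof (induction m)
    case 0
    then show ?case using arcs[of 0] wellformed'(1) by (auto simp: awalk_Nil_iff)
  next
    case (Suc m)
    then show ?case using arcs[of m] arc_implies_awalk[of "(c m, c (Suc m))"] by simp
  qed
  then have p: "awalk (c 0) p (c 0)" using per by (metis p_def)
  have "tl (pawalk_verts (c 0) p) = map (\<lambda>i. c (Suc i)) [0..<n]"
    using awalk_verts_conv'[of "c 0" p "c 0"] p n by (simp add: awalk_def p_def o_def)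
  moreover have "inj_on (\<lambda>i. c (Suc i)) {..<n}"
  proof (rule inj_onI)
    fix i j assume ij: "i \<in> {..<n}" "j \<in> {..<n}" "c (Suc i) = c (Suc j)"
    have red: "c (Suc i) = c (Suc i mod n)" if "i < n" for i
      using that per by (cases "Suc i = n") auto
    have "Suc i mod n = Suc j mod n"
      using ij red[of i] red[of j] n by (intro inj_onD[OF inj]) auto
    then show "i = j" using ij by (auto simp: mod_Suc split: if_splits)
  qed
  ultimately have "distinct (tl (pawalk_verts (c 0) p))"
    by (simp add: distinct_map atLeast0LessThan)
  then have "cycle p" using p n by (auto simp: cycle_def p_def)
  then show ?thesis by (auto simp: p_def)
qed

end

section \<open>The metric of a connected graph\<close>

locale conn_graph = pair_graph +
  assumes connected_G: "Digraph_Component.connected (with_proj G)"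
begin

lemma ex_awalk: "u \<in> pverts G \<Longrightarrow> v \<in> pverts G \<Longrightarrow> \<exists>p. awalk u p v"
  using symmetric_connected_imp_strongly_connected[OF pair_sym_arcs connected_G]
  by (auto simp: strongly_connected_def reachable_awalk)

lemma ex_gdist_awalk:
  "u \<in> pverts G \<Longrightarrow> v \<in> pverts G \<Longrightarrow> \<exists>p. awalk u p v \<and> length p = gdist G u v"
  using ex_awalk ex_awalk_length_gdist by metis

lemma gdist_self [simp]: "u \<in> pverts G \<Longrightarrow> gdist G u u = 0"
  using gdist_le_length[of G u "[]" u] by (simp add: awalk_Nil_iff)

lemma gdist_eq_0_iff: "u \<in> pverts G \<Longrightarrow> v \<in> pverts G \<Longrightarrow> gdist G u v = 0 \<longleftrightarrow> u = v"
  using ex_gdist_awalk[of u v] by (auto simp: awalk_Nil_iff)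

lemma gdist_triangle:
  assumes "u \<in> pverts G" "x \<in> pverts G" "v \<in> pverts G"
  shows "gdist G u v \<le> gdist G u x + gdist G x v"
proof -
  obtain p q where "awalk u p x" "length p = gdist G u x" "awalk x q v" "length q = gdist G x v"
    using ex_gdist_awalk assms by metis
  then show ?thesis using gdist_le_length[of G u "p @ q" v] by auto
qed

lemma gdist_commute:
  assumes "u \<in> pverts G" "v \<in> pverts G"
  shows "gdist G u v = gdist G v u"
proof -
  have "gdist G v u \<le> gdist G u v" if uv: "u \<in> pverts G" "v \<in> pverts G" for u v
  proof -
    obtain p where "awalk u p v" "length p = gdist G u v"
      using ex_gdist_awalk uv by metis
    moreover have "length (rev_path q) = length q" for q :: "('a \<times> 'a) list"
      by (induction q) auto
    ultimately have "awalk v (rev_path p) u" "length (rev_path p) = gdist G u v"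
      by simp_all
    then show ?thesis using gdist_le_length[of G v "rev_path p" u] by simp
  qed
  then show ?thesis using assms by (simp add: order_antisym)
qed

lemma gdist_arc_le:
  assumes "(x, y) \<in> parcs G" "v \<in> pverts G"
  shows "gdist G x v \<le> gdist G y v + 1"
proof -
  obtain p where "awalk y p v" "length p = gdist G y v"
    using ex_gdist_awalk assms wellformed'(2) by metis
  then show ?thesis using gdist_le_length[of G x "(x, y) # p" v] assms by (simp add: awalk_Cons_iff)
qed

lemma gdist_step:
  assumes "x \<in> pverts G" "v \<in> pverts G" "x \<noteq> v"
  shows "\<exists>y. (x, y) \<in> parcs G \<and> gdist G x v = gdist G y v + 1"
proof -
  obtain p where p: "awalk x p v" "length p = gdist G x v"
    using ex_gdist_awalk assms by metis
  then obtain e q where q: "p = e # q" using assms by (cases p) (auto simp: awalk_Nil_iff)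
  then have e: "(x, snd e) \<in> parcs G" "awalk (snd e) q v" using p by (auto simp: awalk_Cons_iff)
  have "gdist G x v \<le> gdist G (snd e) v + 1" by (rule gdist_arc_le[OF e(1) assms(2)])
  moreover have "gdist G (snd e) v \<le> length q" by (rule gdist_le_length[OF e(2)])
  ultimately show ?thesis using e(1) p(2) q by auto
qed

lemma finite_gdists: "finite {gdist G u v |u v. u \<in> pverts G \<and> v \<in> pverts G}"
proof -
  have "{gdist G u v |u v. u \<in> pverts G \<and> v \<in> pverts G} =
      (\<lambda>(u, v). gdist G u v) ` (pverts G \<times> pverts G)" by auto
  then show ?thesis by (simp add: pair_finite_verts)
qed

lemma gdist_le_gdiam: "u \<in> pverts G \<Longrightarrow> v \<in> pverts G \<Longrightarrow> gdist G u v \<le> gdiam G"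
  unfolding gdiam_def by (rule Max_ge[OF finite_gdists]) blast

lemma gdiam_eqI:
  assumes "\<And>u v. u \<in> pverts G \<Longrightarrow> v \<in> pverts G \<Longrightarrow> gdist G u v \<le> n"
    and "u \<in> pverts G" "v \<in> pverts G" "gdist G u v = n"
  shows "gdiam G = n"
  unfolding gdiam_def by (rule Max_eqI[OF finite_gdists]) (use assms in auto)

end

section \<open>Copies of a tree attached to a double star\<close>

primrec side :: "dstar_vertex \<Rightarrow> bool" where
  "side (Hub b) = b"
| "side (Pendant b i) = b"

definition pendants :: "nat \<Rightarrow> dstar_vertex set" where
  "pendants k = {Pendant b i |b i. i < k}"

lemma pendants_eq_image: "pendants k = (\<lambda>(b, i). Pendant b i) ` (UNIV \<times> {..<k})"
  by (auto simp: pendants_def)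

lemma finite_pendants: "finite (pendants k)"
  by (simp add: pendants_eq_image)

lemma sum_pendants:
  "(\<Sum>p\<in>pendants k. f (side p)) = of_nat k * (f True + f False :: 'b::comm_semiring_1)"
proof -
  have "inj_on (\<lambda>(b, i). Pendant b i) (UNIV \<times> {..<k})" by (auto simp: inj_on_def)
  then have "(\<Sum>p\<in>pendants k. f (side p)) = (\<Sum>(b, i)\<in>UNIV \<times> {..<k}. f b)"
    by (simp add: pendants_eq_image sum.reindex case_prod_unfold)
  also have "\<dots> = (\<Sum>b\<in>UNIV. of_nat k * f b)"
    by (simp flip: sum.cartesian_product)
  finally show ?thesis by (simp add: UNIV_bool algebra_simps)
qed

lemma card_pendants: "card (pendants k) = 2 * k"
  using sum_pendants[of "\<lambda>_. 1::nat" k] by simp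

lemma leaves_double_star:
  assumes "0 < k"
  shows "leaves (double_star k) = pendants k"
proof -
  let ?D = "with_proj (double_star k)"
  have "out_arcs ?D (Pendant b i) = {(Pendant b i, Hub b)}" if "i < k" for b i
    using that by (auto simp: out_arcs_def double_star_def Let_def)
  then have pendant: "out_degree ?D (Pendant b i) = 1" if "i < k" for b i
    using that by (simp add: out_degree_def)
  have hub: "out_degree ?D (Hub b) \<noteq> 1" for b
  proof
    assume "out_degree ?D (Hub b) = 1"
    then obtain a where "out_arcs ?D (Hub b) = {a}"
      unfolding out_degree_def by (rule card_1_singletonE)
    \<comment> \<open>Two different arcs leave each hub, the second because \<open>k\<close> is
      positive.\<close>
    moreover have "(Hub b, Hub (\<not> b)) \<in> out_arcs ?D (Hub b)"
      "(Hub b, Pendant b 0) \<in> out_arcs ?D (Hub b)"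
      using assms by (cases b; auto simp: double_star_def Let_def)+
    ultimately show False by auto
  qed
  show ?thesis
    using pendant hub by (auto simp: leaves_def pendants_def double_star_def Let_def)
qed

lemma double_star_arcs:
  "a \<noteq> b \<Longrightarrow> (Hub a, Hub b) \<in> parcs (double_star k)"
  "p \<in> pendants k \<Longrightarrow> (Hub (side p), p) \<in> parcs (double_star k)"
  "p \<in> pendants k \<Longrightarrow> (p, Hub (side p)) \<in> parcs (double_star k)"
  by (cases a; cases b) (auto simp: double_star_def Let_def pendants_def)

section \<open>The grafted graph, its distances and its acyclicity\<close>

locale grafted_double_star = T: conn_graph T for T :: "'a pair_pre_digraph" +
  fixes w :: 'a and k :: nat
  assumes w_in: "w \<in> pverts T" and k_pos: "0 < k"
begin

abbreviation TD :: "(dstar_vertex + dstar_vertex \<times> 'a) pair_pre_digraph" where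
  "TD \<equiv> attach_at_leaves (double_star k) T w"

abbreviation P :: "dstar_vertex set" where
  "P \<equiv> pendants k"

abbreviation ht :: "'a \<Rightarrow> nat" where
  "ht v \<equiv> gdist T v w"

lemma TD_verts: "pverts TD = range (\<lambda>b. Inl (Hub b)) \<union> Inr ` (P \<times> pverts T)"
  using w_in unfolding attach_at_leaves_def leaf_embed_def leaves_double_star[OF k_pos]
  by (auto simp: double_star_def Let_def pendants_def)

lemma TD_vert_cases:
  assumes "x \<in> pverts TD"
  obtains (hub) b where "x = Inl (Hub b)"
  | (copy) p v where "x = Inr (p, v)" "p \<in> P" "v \<in> pverts T"
  using assms by (auto simp: TD_verts)

lemma hub_in_TD [simp]: "Inl (Hub b) \<in> pverts TD"
  and copy_in_TD [simp]: "Inr (p, v) \<in> pverts TD \<longleftrightarrow> p \<in> P \<and> v \<in> pverts T"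
  by (auto simp: TD_verts)

lemma TD_arc_cases:
  assumes "(x, y) \<in> parcs TD"
  obtains (hubs) b where "x = Inl (Hub b)" "y = Inl (Hub (\<not> b))"
  | (down) p where "p \<in> P" "x = Inl (Hub (side p))" "y = Inr (p, w)"
  | (up) p where "p \<in> P" "x = Inr (p, w)" "y = Inl (Hub (side p))"
  | (copy) p u v where "p \<in> P" "(u, v) \<in> parcs T" "x = Inr (p, u)" "y = Inr (p, v)"
proof -
  have "(\<exists>b. x = Inl (Hub b) \<and> y = Inl (Hub (\<not> b))) \<or>
    (\<exists>p. p \<in> P \<and> x = Inl (Hub (side p)) \<and> y = Inr (p, w)) \<or>
    (\<exists>p. p \<in> P \<and> x = Inr (p, w) \<and> y = Inl (Hub (side p))) \<or>
    (\<exists>p u v. p \<in> P \<and> (u, v) \<in> parcs T \<and> x = Inr (p, u) \<and> y = Inr (p, v))"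
    using assms unfolding attach_at_leaves_def leaf_embed_def leaves_double_star[OF k_pos]
    by (auto simp: double_star_def Let_def pendants_def)
  then show thesis using that by blast
qed

lemma embed_arc:
  "(x, y) \<in> parcs (double_star k) \<Longrightarrow>
    (leaf_embed (double_star k) w x, leaf_embed (double_star k) w y) \<in> parcs TD"
  by (auto simp: attach_at_leaves_def)

lemma embed_hub: "leaf_embed (double_star k) w (Hub b) = Inl (Hub b)"
  and embed_pendant: "p \<in> P \<Longrightarrow> leaf_embed (double_star k) w p = Inr (p, w)"
  by (auto simp: leaf_embed_def leaves_double_star[OF k_pos] pendants_def)

lemma hubs_arc: "a \<noteq> b \<Longrightarrow> (Inl (Hub a), Inl (Hub b)) \<in> parcs TD"
  using embed_arc[OF double_star_arcs(1)] by (simp add: embed_hub)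

lemma down_arc: "p \<in> P \<Longrightarrow> (Inl (Hub (side p)), Inr (p, w)) \<in> parcs TD"
  using embed_arc[OF double_star_arcs(2)] by (simp add: embed_hub embed_pendant)

lemma up_arc: "p \<in> P \<Longrightarrow> (Inr (p, w), Inl (Hub (side p))) \<in> parcs TD"
  using embed_arc[OF double_star_arcs(3)] by (simp add: embed_hub embed_pendant)

lemma copy_arc: "p \<in> P \<Longrightarrow> (u, v) \<in> parcs T \<Longrightarrow> (Inr (p, u), Inr (p, v)) \<in> parcs TD"
  by (auto simp: attach_at_leaves_def leaves_double_star[OF k_pos])

sublocale TD: pair_graph TD
proof -
  have arc: "x \<in> pverts TD \<and> y \<in> pverts TD \<and> x \<noteq> y \<and> (y, x) \<in> parcs TD"
    if "(x, y) \<in> parcs TD" for x y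
    using that
  proof (cases rule: TD_arc_cases)
    case (copy p u v)
    then show ?thesis
      using T.wellformed'[OF copy(2)] T.no_loops'[OF copy(2)] T.arcs_symmetric[OF copy(2)]
      by (simp add: copy_arc)
  qed (use w_in in \<open>auto simp: hubs_arc down_arc up_arc\<close>)
  have fin: "finite (pverts TD)"
    by (simp add: TD_verts finite_pendants T.pair_finite_verts)
  moreover have "parcs TD \<subseteq> pverts TD \<times> pverts TD" using arc by auto
  ultimately have "finite (parcs TD)" by (meson finite_SigmaI finite_subset)
  then show "pair_graph TD"
    using arc fin by unfold_locales (auto simp: symmetric_def sym_def)
qed

text \<open>A path between different copies passes through both roots \<open>w\<close>. The
  constants 0 to 3 are the distances in the double star between the hubs or leaves
  concerned.\<close>

fun tdist where
  "tdist (Inl x) (Inl y) = (if side x = side y then 0 else 1)"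
| "tdist (Inl x) (Inr (q, v)) = ht v + (if side x = side q then 1 else 2)"
| "tdist (Inr (p, u)) (Inl y) = ht u + (if side p = side y then 1 else 2)"
| "tdist (Inr (p, u)) (Inr (q, v)) =
    (if p = q then gdist T u v else ht u + ht v + (if side p = side q then 2 else 3))"

lemma tdist_arc_le:
  assumes "(x, y) \<in> parcs TD" "v \<in> pverts TD"
  shows "tdist x v \<le> tdist y v + 1"
  using assms(2)
proof (cases rule: TD_vert_cases)
  case (hub b)
  show ?thesis
    using assms(1) by (cases rule: TD_arc_cases) (use hub T.gdist_arc_le w_in in auto)
next
  case (copy q v')
  have sym: "gdist T w v' = ht v'"
    using T.gdist_commute w_in copy by simp
  show ?thesis
    using assms(1) by (cases rule: TD_arc_cases) (use copy w_in T.gdist_arc_le sym in auto)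
qed

text \<open>The first step towards \<open>v\<close>: from a hub, down into the copy of
  \<open>v\<close> if that lies on its side, otherwise across to the other hub; inside a copy,
  towards \<open>v\<close> if \<open>v\<close> is there too, otherwise towards \<open>w\<close> and
  from \<open>w\<close> up to the hub.\<close>

lemma tdist_step:
  assumes x: "x \<in> pverts TD" and v: "v \<in> pverts TD" and "x \<noteq> v"
  shows "\<exists>y. (x, y) \<in> parcs TD \<and> tdist x v = tdist y v + 1"
  using x
proof (cases rule: TD_vert_cases)
  case (hub a)
  show ?thesis
  proof (cases "\<exists>q v'. v = Inr (q, v') \<and> q \<in> P \<and> v' \<in> pverts T \<and> side q = a")
    case True
    then obtain q v' where q: "v = Inr (q, v')" "q \<in> P" "v' \<in> pverts T" "side q = a" by blast
    then have "gdist T w v' = ht v'" using T.gdist_commute w_in by simp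
    then show ?thesis using hub q down_arc[of q] by (intro exI[of _ "Inr (q, w)"]) auto
  next
    case False
    have "(x, Inl (Hub (\<not> a))) \<in> parcs TD" using hub hubs_arc[of a "\<not> a"] by simp
    moreover have "tdist x v = tdist (Inl (Hub (\<not> a)) :: dstar_vertex + dstar_vertex \<times> 'a) v + 1"
      using v False hub \<open>x \<noteq> v\<close> by (cases rule: TD_vert_cases) auto
    ultimately show ?thesis by blast
  qed
next
  case (copy p u)
  show ?thesis
  proof (cases "\<exists>v'. v = Inr (p, v')")
    case True
    then obtain v' where v': "v = Inr (p, v')" "v' \<in> pverts T" using v by auto
    then obtain y where "(u, y) \<in> parcs T" "gdist T u v' = gdist T y v' + 1"
      using T.gdist_step[of u v'] copy \<open>x \<noteq> v\<close> by auto
    then show ?thesis using copy v' copy_arc by (intro exI[of _ "Inr (p, y)"]) auto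
  next
    case other: False
    show ?thesis
    proof (cases "u = w")
      case True
      have "tdist x v = tdist (Inl (Hub (side p)) :: dstar_vertex + dstar_vertex \<times> 'a) v + 1"
        using v other copy True w_in by (cases rule: TD_vert_cases) auto
      then show ?thesis using up_arc copy True by blast
    next
      case False
      then obtain y where y: "(u, y) \<in> parcs T" "ht u = ht y + 1"
        using T.gdist_step[of u w] copy w_in by auto
      have "tdist x v = tdist (Inr (p, y)) v + 1"
        using v other copy y by (cases rule: TD_vert_cases) auto
      then show ?thesis using copy_arc copy y by blast
    qed
  qed
qed

lemma tdist_self: "v \<in> pverts TD \<Longrightarrow> tdist v v = 0"
  by (erule TD_vert_cases) auto

lemma gdist_TD: "u \<in> pverts TD \<Longrightarrow> v \<in> pverts TD \<Longrightarrow> gdist TD u v = tdist u v"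
  by (rule TD.gdist_eqI[where \<delta> = "\<lambda>x. tdist x v"];
      (assumption | rule tdist_self tdist_arc_le tdist_step; assumption))

sublocale TD: conn_graph TD
proof
  have "\<exists>p. TD.awalk u p v" if "u \<in> pverts TD" "v \<in> pverts TD" for u v
    using that
    using that
    by - (rule TD.ex_awalkI[where \<delta> = "\<lambda>x. tdist x v"];
        (assumption | rule tdist_self tdist_arc_le tdist_step; assumption))
  then have "u \<rightarrow>\<^sup>*\<^bsub>mk_symmetric (with_proj TD)\<^esub> v" if "u \<in> pverts TD" "v \<in> pverts TD" for u v
    using that by (simp add: TD.reachable_mk_symmetric_eq[OF TD.pair_sym_arcs] TD.reachable_awalk)
  moreover have "pverts TD \<noteq> {}" using hub_in_TD by blast
  ultimately show "Digraph_Component.connected (with_proj TD)"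
    by (intro TD.connectedI) auto
qed

text \<open>The hubs alone are too few for a long cycle, and a cycle inside one copy projects to a
  cycle of \<open>T\<close>. A cycle that meets a copy without staying in it must traverse the edge
  between \<open>w\<close> and the hub in both directions, which forces length at most 2.\<close>

lemma no_long_cycle_TD:
  assumes T: "\<not> (\<exists>p. T.cycle p \<and> 3 \<le> length p)"
  shows "\<not> (\<exists>p. TD.cycle p \<and> 3 \<le> length p)"
proof
  assume "\<exists>p. TD.cycle p \<and> 3 \<le> length p"
  then obtain q where q: "TD.cycle q" "3 \<le> length q" by blast
  define n where "n = length q"
  have n: "3 \<le> n" using q by (simp add: n_def)
  obtain c where per: "\<And>i. c (i + n) = c i"
    and arcs: "\<And>i. (c i, c (Suc i)) \<in> parcs TD" and inj: "inj_on c {..<n}"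
    unfolding n_def by (rule TD.cyclic_sequence_of_cycle[OF q(1)]) blast
  have per': "c (i + j * n) = c i" for i j
  proof (induction j)
    case (Suc j)
    then show ?case using per[of "i + j * n"] by (simp add: algebra_simps)
  qed simp
  have mod_eq: "i mod n = j mod n" if "c i = c j" for i j
  proof -
    have red: "c (i mod n) = c i" for i using per'[of "i mod n" "i div n"] by simp
    show ?thesis using that red n by (intro inj_onD[OF inj]) auto
  qed
  have in_verts: "c i \<in> pverts TD" for i
    using arcs TD.wellformed'(1) by blast
  show False
  proof (cases "\<exists>j p u. c j = Inr (p, u)")
    case False
    then have hubs: "c i \<in> range (\<lambda>b. Inl (Hub b))" for i
      using in_verts[of i] by (auto simp: TD_verts)
    have "c ` {..<n} \<subseteq> range (\<lambda>b. Inl (Hub b))" using hubs by blast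
    then have "card (c ` {..<n}) \<le> card (range (\<lambda>b. Inl (Hub b) :: dstar_vertex + dstar_vertex \<times> 'a))"
      by (intro card_mono) auto
    also have "\<dots> \<le> 2" using card_image_le[of UNIV "\<lambda>b. Inl (Hub b)"] by simp
    finally show False using inj n by (simp add: card_image)
  next
    case True
    then obtain j p u where j: "c j = Inr (p, u)" by blast
    define inp where "inp i \<longleftrightarrow> (\<exists>u. c i = Inr (p, u))" for i
    have p: "p \<in> P" using in_verts[of j] j by simp
    have inp_per: "inp (i + m * n) = inp i" for i m by (simp add: inp_def per')
    \<comment> \<open>A cycle can enter and leave the copy at \<open>p\<close> only through the arcs between \<open>w\<close> and the hub.\<close>
    have exits: "c i = Inr (p, w)" "c (Suc i) = Inl (Hub (side p))" if "inp i" "\<not> inp (Suc i)" for i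
      using arcs[of i] that by (auto elim!: TD_arc_cases simp: inp_def)
    have enters: "c i = Inl (Hub (side p))" "c (Suc i) = Inr (p, w)" if "\<not> inp i" "inp (Suc i)" for i
      using arcs[of i] that by (auto elim!: TD_arc_cases simp: inp_def)
    have switch: "\<exists>i\<ge>a. R i \<and> \<not> R (Suc i)" if "a \<le> b" "R a" "\<not> R b" for R and a b :: nat
      using that
    proof (induction "b - a" arbitrary: a)
      case (Suc m)
      show ?case
      proof (cases "R (Suc a)")
        case True
        have "\<exists>i\<ge>Suc a. R i \<and> \<not> R (Suc i)"
          using Suc.hyps Suc.prems True by (intro Suc.hyps(1)) auto
        then show ?thesis using Suc_leD by blast
      qed (use Suc in auto)
    qed simp
    \<comment> \<open>Adding whole periods moves an index past any bound, so both an entry into the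
      copy and a later exit can be found by searching forwards.\<close>
    have far: "\<exists>m. b \<le> a + m * n" for a b
      using n by (intro exI[of _ b]) (simp add: trans_le_add2)
    show False
    proof (cases "\<forall>i. inp i")
      case True
      define c' where "c' i = snd (projr (c i))" for i
      have c: "c i = Inr (p, c' i)" for i using True unfolding inp_def c'_def by (metis snd_conv sum.sel(2))
      have "(c' i, c' (Suc i)) \<in> parcs T" for i
        using arcs[of i] by (auto elim!: TD_arc_cases simp: c)
      moreover have "inj_on c' {..<n}"
        using inj by (auto simp: inj_on_def c)
      moreover have "c' n = c' 0" using per[of 0] by (simp add: c)
      ultimately have "\<exists>p. T.cycle p \<and> length p = n"
        using n by (intro T.cycle_of_cyclic_sequence[of c']) auto
      then show False using T n by blast
    next
      case False
      then obtain i0 where i0: "\<not> inp i0" by blast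
      obtain m where "i0 \<le> j + m * n" using far by blast
      moreover have "inp (j + m * n)" using j inp_per unfolding inp_def by metis
      ultimately obtain i where i: "\<not> inp i" "inp (Suc i)"
        using switch[of i0 "j + m * n" "\<lambda>i. \<not> inp i"] i0 by blast
      obtain m where "Suc i \<le> i0 + m * n" using far by blast
      moreover have "\<not> inp (i0 + m * n)" using i0 inp_per by metis
      ultimately obtain i' where i': "inp i'" "\<not> inp (Suc i')"
        using switch[of "Suc i" "i0 + m * n" inp] i by blast
      \<comment> \<open>Entry and exit both visit \<open>w\<close> of this copy and the hub on its
        side, and a cycle visits each vertex once per period. Hence two steps lead back to the
        start.\<close>
      have "Suc i mod n = i' mod n" "Suc i' mod n = i mod n"
        using enters[OF i] exits[OF i'] by (auto intro: mod_eq)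
      then have "Suc (Suc i) mod n = i mod n" by (metis mod_Suc_eq)
      then have "n dvd Suc (Suc i) - i" using mod_eq_dvd_iff_nat[of i "Suc (Suc i)" n] by simp
      then show False using n by (auto dest: dvd_imp_le)
    qed
  qed
qed

lemma utree_TD:
  assumes "utree T"
  shows "utree TD"
  unfolding utree_def
  using assms no_long_cycle_TD TD.connected_G TD.pair_graph by (simp add: utree_def)

end

section \<open>Radio labelings\<close>

text \<open>In the order of the labels the gaps telescope, and each level is subtracted at most
  twice.\<close>

lemma radio_gaps_sum_le:
  fixes f lev :: "'b \<Rightarrow> int"
  assumes "finite A" "A \<noteq> {}"
    and "\<And>x y. x \<in> A \<Longrightarrow> y \<in> A \<Longrightarrow> x \<noteq> y \<Longrightarrow> \<bar>f x - f y\<bar> \<ge> D - lev x - lev y"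
    and "\<And>x. x \<in> A \<Longrightarrow> 0 \<le> f x"
    and "\<And>x. x \<in> A \<Longrightarrow> 0 \<le> lev x"
  shows "\<exists>x\<in>A. (int (card A) - 1) * D - 2 * (\<Sum>y\<in>A. lev y) \<le> f x"
proof -
  \<comment> \<open>The level of the vertex with the largest label is counted only once in the sum of the gaps.\<close>
  have "\<exists>x\<in>A. (\<forall>y\<in>A. f y \<le> f x) \<and> (int (card A) - 1) * D - 2 * (\<Sum>y\<in>A. lev y) + lev x \<le> f x"
    using assms
  \<comment> \<open>The rule inserts elements in order of increasing label, which replaces an
    explicit sorting. It does not promise that the new element is fresh, hence the case
    \<open>x \<in> A\<close> below.\<close>
  proof (induction A rule: finite_ranking_induct[where f = f])
    case (insert x A)
    have IH: "\<exists>z\<in>A. (\<forall>y\<in>A. f y \<le> f z) \<and>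
        (int (card A) - 1) * D - 2 * (\<Sum>y\<in>A. lev y) + lev z \<le> f z" if "A \<noteq> {}"
      by (rule insert.IH[OF that]) (use insert.prems in auto)
    consider "A = {}" | "x \<in> A" | "x \<notin> A" "A \<noteq> {}" by blast
    then show ?case
    proof cases
      case 1
      then show ?thesis using insert.prems(3,4)[of x] by simp
    next
      case 2
      then have "insert x A = A" "A \<noteq> {}" by auto
      then show ?thesis using IH by simp
    next
      case 3
      then obtain z where z: "z \<in> A"
        "(int (card A) - 1) * D - 2 * (\<Sum>y\<in>A. lev y) + lev z \<le> f z"
        using IH by blast
      have "f x - f z \<ge> D - lev x - lev z"
        using insert.hyps(2)[OF z(1)] insert.prems(2)[of x z] z(1) 3 by auto
      moreover have "int (card (insert x A)) = int (card A) + 1"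
        "(\<Sum>y\<in>insert x A. lev y) = lev x + (\<Sum>y\<in>A. lev y)"
        using 3 insert.hyps(1) by simp_all
      ultimately have "(int (card (insert x A)) - 1) * D - 2 * (\<Sum>y\<in>insert x A. lev y) + lev x \<le> f x"
        using z(2) by (simp add: algebra_simps)
      then show ?thesis using insert.hyps(2) by auto
    qed
  qed simp
  then obtain x where "x \<in> A"
    "(int (card A) - 1) * D - 2 * (\<Sum>y\<in>A. lev y) + lev x \<le> f x" by blast
  then show ?thesis using assms(5)[of x] by (intro bexI[of _ x]) auto
qed

text \<open>Spreading an injective numbering by the factor \<open>gdiam G + 1\<close> satisfies
  every radio condition. Thus the \<open>LEAST\<close> in \<open>radio_number\<close> is
  attained.\<close>

lemma (in pair_fin_digraph) ex_radio_labeling: "\<exists>f. radio_labeling G f"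
proof -
  obtain h :: "'a \<Rightarrow> nat" where h: "inj_on h (pverts G)"
    using finite_imp_inj_to_nat_seg[OF pair_finite_verts] by blast
  let ?f = "\<lambda>v. (gdiam G + 1) * h v"
  have "radio_labeling G ?f"
    unfolding radio_labeling_def
  proof (intro ballI impI)
    fix u v assume that: "u \<in> pverts G" "v \<in> pverts G" "u \<noteq> v"
    have "h u \<noteq> h v" using h that by (auto dest: inj_onD)
    then have "1 \<le> \<bar>int (h u) - int (h v)\<bar>" by simp
    then have "int (gdiam G + 1) * 1 \<le> int (gdiam G + 1) * \<bar>int (h u) - int (h v)\<bar>"
      by (intro mult_left_mono) auto
    also have "\<dots> = \<bar>int (gdiam G + 1) * (int (h u) - int (h v))\<bar>"
      by (simp add: abs_mult)
    also have "int (gdiam G + 1) * (int (h u) - int (h v)) = int (?f u) - int (?f v)"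
      by (simp only: of_nat_mult right_diff_distrib)
    finally show "int (gdiam G) + 1 - int (gdist G u v) \<le> \<bar>int (?f u) - int (?f v)\<bar>" by simp
  qed
  then show ?thesis by blast
qed

lemma (in pair_fin_digraph) ex_optimal_radio_labeling:
  "\<exists>f. radio_labeling G f \<and> label_span G f = radio_number G"
  unfolding radio_number_def by (rule LeastI_ex) (use ex_radio_labeling in blast)

lemma radio_number_le: "radio_labeling G f \<Longrightarrow> radio_number G \<le> label_span G f"
  unfolding radio_number_def by (rule Least_le) blast

section \<open>Weight centers and the lower bound\<close>

context grafted_double_star
begin

lemma sum_TD: "(\<Sum>x\<in>pverts TD. g x) =
  g (Inl (Hub True)) + g (Inl (Hub False)) + (\<Sum>p\<in>P. \<Sum>v\<in>pverts T. g (Inr (p, v)))"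
proof -
  have "(\<Sum>x\<in>pverts TD. g x) =
      (\<Sum>x\<in>range (\<lambda>b. Inl (Hub b)). g x) + (\<Sum>x\<in>Inr ` (P \<times> pverts T). g x)"
    unfolding TD_verts
    by (rule sum.union_disjoint) (auto simp: finite_pendants T.pair_finite_verts)
  also have "(\<Sum>x\<in>range (\<lambda>b. Inl (Hub b)). g x) = g (Inl (Hub True)) + g (Inl (Hub False))"
    by (subst sum.reindex) (auto simp: inj_on_def UNIV_bool add.commute)
  also have "(\<Sum>x\<in>Inr ` (P \<times> pverts T). g x) = (\<Sum>p\<in>P. \<Sum>v\<in>pverts T. g (Inr (p, v)))"
    by (subst sum.reindex) (auto simp: inj_on_def sum.cartesian_product intro!: sum.cong)
  finally show ?thesis .
qed

lemma card_TD: "card (pverts TD) = 2 + 2 * k * card (pverts T)"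
  using sum_TD[of "\<lambda>_. 1::nat"] by (simp add: card_pendants)

section \<open>Height, diameter and weights\<close>

definition total_height :: nat where
  "total_height = (\<Sum>v\<in>pverts T. ht v)"

definition height :: nat where
  "height = Max (ht ` pverts T)"

lemma ht_le_height: "v \<in> pverts T \<Longrightarrow> ht v \<le> height"
  by (simp add: height_def T.pair_finite_verts)

lemma gdist_le_ht: "u \<in> pverts T \<Longrightarrow> v \<in> pverts T \<Longrightarrow> gdist T u v \<le> ht u + ht v"
  using T.gdist_triangle[of u w v] T.gdist_commute[of v w] w_in by simp

lemma gdiam_T_le: "gdiam T \<le> 2 * height"
proof -
  have "gdist T u v \<le> 2 * height" if "u \<in> pverts T" "v \<in> pverts T" for u v
    using gdist_le_ht[OF that] ht_le_height[OF that(1)] ht_le_height[OF that(2)] by linarith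
  then show ?thesis
    unfolding gdiam_def using w_in by (subst Max_le_iff[OF T.finite_gdists]) auto
qed

lemma gdiam_TD: "gdiam TD = 2 * height + 3"
proof -
  have "height \<in> ht ` pverts T"
    unfolding height_def using w_in by (intro Max_in) (auto simp: T.pair_finite_verts)
  then obtain v where v: "v \<in> pverts T" "ht v = height" by auto
  \<comment> \<open>The diameter is attained by copies of a deepest vertex on opposite
    sides.\<close>
  let ?x = "\<lambda>b. Inr (Pendant b 0, v) :: dstar_vertex + dstar_vertex \<times> 'a"
  have x: "?x b \<in> pverts TD" for b
    using v k_pos by (simp add: pendants_def)
  have le: "tdist x y \<le> 2 * height + 3" if "x \<in> pverts TD" "y \<in> pverts TD" for x y
    using that(1)
  proof (cases rule: TD_vert_cases)
    case (hub b)
    show ?thesis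
      using that(2) by (cases rule: TD_vert_cases) (use hub ht_le_height in \<open>force+\<close>)
  next
    case (copy p u)
    show ?thesis
      using that(2)
    proof (cases rule: TD_vert_cases)
      case (hub b)
      then show ?thesis using copy ht_le_height[of u] by simp
    next
      case (copy q v')
      then show ?thesis
        using \<open>x = Inr (p, u)\<close> \<open>u \<in> pverts T\<close> ht_le_height[of u] ht_le_height[of v']
          gdist_le_ht[of u v'] by auto
    qed
  qed
  show ?thesis
    by (rule TD.gdiam_eqI[OF _ x[of True] x[of False]]) (use x le v in \<open>auto simp: gdist_TD\<close>)
qed

lemma weight_hub: "weight TD (Inl (Hub b)) = 1 + 2 * k * total_height + 3 * k * card (pverts T)"
proof -
  have "weight TD (Inl (Hub b)) =
      1 + (\<Sum>p\<in>P. total_height + card (pverts T) * (if side p = b then 1 else 2))"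
    by (cases b)
      (auto simp: weight_def sum_TD gdist_TD total_height_def sum.distrib intro!: sum.cong)
  then show ?thesis
    using sum_pendants[of "\<lambda>c. total_height + card (pverts T) * (if c = b then 1 else 2)" k]
    by (cases b) (simp_all add: algebra_simps)
qed

text \<open>Compare \<open>u\<close> in the copy at \<open>p\<close> with the hub above it. Within
  that copy the hub costs at most \<open>card (pverts T)\<close> more, since \<open>w\<close> has
  weight at most that of \<open>u\<close>. Every vertex of another copy is nearer to the hub by
  \<open>ht u + 1\<close>, and one other copy already makes up for the loss. The distances to the
  two hubs make the inequality strict.\<close>

lemma weight_hub_less_weight_copy:
  assumes "weight T w \<le> weight T u" and p: "p \<in> P" and u: "u \<in> pverts T"
  shows "weight TD (Inl (Hub (side p))) < weight TD (Inr (p, u))"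
proof -
  let ?V = "pverts T"
  define D where "D q v = ht v + (if side q = side p then 1 else 2)" for q v
  have hub: "weight TD (Inl (Hub (side p))) =
      1 + ((total_height + card ?V) + (\<Sum>q\<in>P - {p}. \<Sum>v\<in>?V. D q v))"
  proof -
    have "weight TD (Inl (Hub (side p))) = 1 + (\<Sum>q\<in>P. \<Sum>v\<in>?V. D q v)"
      by (cases "side p") (auto simp: weight_def sum_TD gdist_TD D_def intro!: sum.cong)
    then show ?thesis
      by (simp only: sum.remove[OF finite_pendants p]) (simp add: D_def total_height_def sum.distrib sum_Suc)
  qed
  have copy: "weight TD (Inr (p, u)) = 2 * ht u + 3 +
      (weight T u + (\<Sum>q\<in>P - {p}. \<Sum>v\<in>?V. D q v + ht u + 1))"
  proof -
    have "weight TD (Inr (p, u)) =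
        2 * ht u + 3 + (\<Sum>q\<in>P. \<Sum>v\<in>?V. tdist (Inr (q, v)) (Inr (p, u)))"
      using p u by (cases "side p") (auto simp: weight_def sum_TD gdist_TD intro!: sum.cong)
    also have "(\<Sum>q\<in>P. \<Sum>v\<in>?V. tdist (Inr (q, v)) (Inr (p, u))) =
        weight T u + (\<Sum>q\<in>P - {p}. \<Sum>v\<in>?V. tdist (Inr (q, v)) (Inr (p, u)))"
      by (simp add: sum.remove[OF finite_pendants p] weight_def)
    also have "(\<Sum>q\<in>P - {p}. \<Sum>v\<in>?V. tdist (Inr (q, v)) (Inr (p, u))) =
        (\<Sum>q\<in>P - {p}. \<Sum>v\<in>?V. D q v + ht u + 1)"
      by (intro sum.cong) (auto simp: D_def)
    finally show ?thesis .
  qed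
  have "card (P - {p}) = 2 * k - 1" using p finite_pendants by (simp add: card_pendants)
  then have "1 \<le> card (P - {p})" using k_pos by simp
  then have "card ?V \<le> card (P - {p}) * card ?V" using mult_le_mono1[of 1] by simp
  then have "(\<Sum>q\<in>P - {p}. \<Sum>v\<in>?V. D q v) + card ?V \<le>
      (\<Sum>q\<in>P - {p}. \<Sum>v\<in>?V. D q v) + card (P - {p}) * card ?V" by simp
  also have "\<dots> = (\<Sum>q\<in>P - {p}. \<Sum>v\<in>?V. D q v + 1)"
    by (simp add: sum.distrib sum_Suc)
  also have "\<dots> \<le> (\<Sum>q\<in>P - {p}. \<Sum>v\<in>?V. D q v + ht u + 1)"
    by (intro sum_mono) simp
  finally have "(\<Sum>q\<in>P - {p}. \<Sum>v\<in>?V. D q v) + card ?V \<le>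
    (\<Sum>q\<in>P - {p}. \<Sum>v\<in>?V. D q v + ht u + 1)" .
  moreover have "total_height \<le> weight T u"
    using assms(1) by (simp add: weight_def total_height_def)
  ultimately show ?thesis unfolding hub copy by linarith
qed

lemma weight_centers_TD:
  assumes "w \<in> weight_centers T"
  shows "weight_centers TD = {Inl (Hub True), Inl (Hub False)}"
proof -
  \<comment> \<open>Both hubs have the same weight by \<open>weight_hub\<close>, so the comparison
    with the hub on the side of \<open>p\<close> serves for either.\<close>
  have less: "weight TD (Inl (Hub b)) < weight TD (Inr (p, u))"
    if "p \<in> P" "u \<in> pverts T" for b p u
    using weight_hub_less_weight_copy[of u p] assms that by (simp add: weight_hub weight_centers_def)
  have hub_le: "weight TD (Inl (Hub b)) \<le> weight TD x" if "x \<in> pverts TD" for b x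
    using that less by (cases rule: TD_vert_cases) (auto simp: weight_hub intro: less_imp_le)
  show ?thesis
  proof (intro set_eqI iffI)
    fix x assume "x \<in> weight_centers TD"
    then have x: "x \<in> pverts TD" "weight TD x \<le> weight TD (Inl (Hub True))"
      by (auto simp: weight_centers_def)
    from x(1) show "x \<in> {Inl (Hub True), Inl (Hub False)}"
    proof (cases rule: TD_vert_cases)
      case (hub b)
      then show ?thesis by (cases b) auto
    next
      case (copy p v)
      then show ?thesis using x(2) less[of p v True] by simp
    qed
  qed (auto simp: weight_centers_def hub_le)
qed

section \<open>Levels and the lower bound\<close>

fun tlevel :: "dstar_vertex + dstar_vertex \<times> 'a \<Rightarrow> nat" where
  "tlevel (Inl x) = 0"
| "tlevel (Inr (p, v)) = ht v + 1"

lemma level_TD: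
  assumes "w \<in> weight_centers T" and "x \<in> pverts TD"
  shows "level TD x = tlevel x"
proof -
  have "{gdist TD x y |y. y \<in> weight_centers TD} =
      {gdist TD x (Inl (Hub True)), gdist TD x (Inl (Hub False))}"
    unfolding weight_centers_TD[OF assms(1)] by blast
  then have "{gdist TD x y |y. y \<in> weight_centers TD} =
      {tdist x (Inl (Hub True)), tdist x (Inl (Hub False))}"
    using assms(2) by (simp add: gdist_TD)
  moreover have "min (tdist x (Inl (Hub True))) (tdist x (Inl (Hub False))) = tlevel x"
    using assms(2) by (cases rule: TD_vert_cases) auto
  ultimately show ?thesis by (simp add: level_def)
qed

lemma lb_TD:
  assumes "w \<in> weight_centers T"
  shows "lb TD = (int (card (pverts TD)) - 1) * int (gdiam TD) - 2 * (\<Sum>x\<in>pverts TD. int (tlevel x))"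
proof -
  have "int (total_level TD) = (\<Sum>x\<in>pverts TD. int (tlevel x))"
    unfolding total_level_def of_nat_sum using level_TD[OF assms] by (intro sum.cong) simp_all
  moreover have "center_eps TD = 0"
    unfolding center_eps_def weight_centers_TD[OF assms] by simp
  ultimately show ?thesis unfolding lb_def by simp
qed

lemma lb_TD_eq:
  assumes "w \<in> weight_centers T"
  shows "lb TD = (2 * int k * int (card (pverts T)) + 1) * (2 * int height + 3)
    - 4 * int k * (int total_height + int (card (pverts T)))"
proof -
  have "(\<Sum>x\<in>pverts TD. int (tlevel x)) = 2 * int k * (int total_height + int (card (pverts T)))"
    by (simp add: sum_TD sum.distrib card_pendants total_height_def)
  then show ?thesis
    unfolding lb_TD[OF assms] gdiam_TD card_TD by (simp add: algebra_simps)
qed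

text \<open>Climb from \<open>x\<close> to its hub, cross the edge between the hubs at most once,
  and descend to \<open>y\<close>.\<close>

lemma tdist_le_tlevel:
  assumes "x \<in> pverts TD" "y \<in> pverts TD"
  shows "tdist x y \<le> tlevel x + tlevel y + 1"
  using assms
proof (elim TD_vert_cases)
  fix p q u v assume *: "x = Inr (p, u)" "y = Inr (q, v)" "u \<in> pverts T" "v \<in> pverts T"
  then show ?thesis using gdist_le_ht[of u v] by simp
qed auto

lemma lb_TD_le_span:
  assumes "w \<in> weight_centers T" and f: "radio_labeling TD f"
  shows "lb TD \<le> int (label_span TD f)"
proof -
  have gap: "\<bar>int (f x) - int (f y)\<bar> \<ge> int (gdiam TD) - int (tlevel x) - int (tlevel y)"
    if "x \<in> pverts TD" "y \<in> pverts TD" "x \<noteq> y" for x y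
  proof -
    have "int (gdiam TD) + 1 - int (gdist TD x y) \<le> \<bar>int (f x) - int (f y)\<bar>"
      using f that unfolding radio_labeling_def by blast
    then show ?thesis
      using tdist_le_tlevel[OF that(1,2)] unfolding gdist_TD[OF that(1,2)] by linarith
  qed
  have "\<exists>x\<in>pverts TD. (int (card (pverts TD)) - 1) * int (gdiam TD) -
      2 * (\<Sum>x\<in>pverts TD. int (tlevel x)) \<le> int (f x)"
  proof (rule radio_gaps_sum_le)
    show "pverts TD \<noteq> {}" using hub_in_TD[of True] by blast
  qed (use gap TD.pair_finite_verts in simp_all)
  then obtain x where "x \<in> pverts TD" "lb TD \<le> int (f x)"
    unfolding lb_TD[OF assms(1)] by blast
  moreover from this have "f x \<le> label_span TD f"
    using TD.pair_finite_verts by (simp add: label_span_def)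
  ultimately show ?thesis by linarith
qed

end

section \<open>A labeling attaining the lower bound\<close>

text \<open>The parity of the index alternates between the two sides.\<close>

primrec copy_index :: "dstar_vertex \<Rightarrow> int" where
  "copy_index (Hub b) = 0"
| "copy_index (Pendant b i) = 2 * int i + (if b then 0 else 1)"

lemma copy_index_nonneg: "p \<in> pendants k \<Longrightarrow> 0 \<le> copy_index p"
  and copy_index_less: "p \<in> pendants k \<Longrightarrow> copy_index p < 2 * int k"
  and even_copy_index_iff: "p \<in> pendants k \<Longrightarrow> even (copy_index p) \<longleftrightarrow> side p"
  by (auto simp: pendants_def split: if_splits)

lemma copy_index_inj:
  assumes "p \<in> pendants k" "q \<in> pendants k" "copy_index p = copy_index q"
  shows "p = q"
proof -
  have "side p = side q" using assms even_copy_index_iff by metis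
  then show ?thesis using assms by (auto simp: pendants_def split: if_splits)
qed

section \<open>Construction of the labeling from a labeling \<open>F\<close> of
  \<open>T\<close>\<close>

locale grafted_labeling = grafted_double_star +
  fixes F :: "'a \<Rightarrow> nat" and a z :: 'a
  assumes F: "radio_labeling T F"
    and k_ge_2: "2 \<le> k"
    and a: "a \<in> pverts T" "\<And>v. v \<in> pverts T \<Longrightarrow> F a \<le> F v"
    and z: "z \<in> pverts T" "\<And>v. v \<in> pverts T \<Longrightarrow> F v \<le> F z"
begin

text \<open>The label distance between successive copies of \<open>v\<close>.\<close>

definition slack :: "'a \<Rightarrow> int" where
  "slack v = 2 * int height + 1 - 2 * int (ht v)"

text \<open>The growth from the first copy of \<open>v\<close> to the first copy of its successor,
  apart from the increase of \<open>F\<close>: there are \<open>2 * k - 1\<close> gaps between the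
  copies of \<open>v\<close>, and then the surplus over \<open>F\<close> on passing to the
  successor.\<close>

definition stretch :: "'a \<Rightarrow> int" where
  "stretch v = (2 * int k - 1) * slack v + (2 * int height - int (gdiam T))"

text \<open>The label of the first copy of \<open>v\<close> relative to the first copy of
  \<open>a\<close>; the increases of \<open>F\<close> along the way telescope.\<close>

definition offset :: "'a \<Rightarrow> int" where
  "offset v = (\<Sum>x | x \<in> pverts T \<and> F x < F v. stretch x) + (int (F v) - int (F a))"

text \<open>The last copy of \<open>z\<close> and the final hub lie on opposite sides, at distance
  \<open>ht z + 2\<close>. The final hub therefore follows after the least admissible gap
  \<open>2 * height + 2 - ht z\<close>; the start at \<open>a\<close> is the mirror image.\<close>

definition top_label :: int where
  "top_label = 4 * int height + 4 - int (ht a) - int (ht z) + offset z + (2 * int k - 1) * slack z"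

text \<open>\<open>Hub False\<close> comes first because the copy of index 0 is on the side
  \<open>True\<close>, and \<open>Hub True\<close> last because index \<open>2 * k - 1\<close> is on
  the side \<open>False\<close>. Integer values avoid truncated subtraction.\<close>

fun label :: "dstar_vertex + dstar_vertex \<times> 'a \<Rightarrow> int" where
  "label (Inl x) = (if side x then top_label else 0)"
| "label (Inr (p, v)) = 2 * int height + 2 - int (ht a) + offset v + copy_index p * slack v"

lemma slack_ge_1: "v \<in> pverts T \<Longrightarrow> 1 \<le> slack v"
  using ht_le_height[of v] by (simp add: slack_def)

lemma stretch_nonneg: "v \<in> pverts T \<Longrightarrow> 0 \<le> stretch v"
  using slack_ge_1[of v] gdiam_T_le k_ge_2 by (simp add: stretch_def)

text \<open>No distance exceeds the diameter, so distinct vertices have labels at least 1 apart and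
  \<open>F\<close> orders the vertices strictly.\<close>

lemma F_eq_iff:
  assumes "u \<in> pverts T" "v \<in> pverts T"
  shows "F u = F v \<longleftrightarrow> u = v"
proof (rule ccontr)
  assume "\<not> ?thesis"
  then have "F u = F v" "u \<noteq> v" by auto
  then have "int (gdiam T) + 1 - int (gdist T u v) \<le> 0"
    using F assms unfolding radio_labeling_def by fastforce
  then show False using T.gdist_le_gdiam[OF assms] by simp
qed

lemma offset_a: "offset a = 0"
proof -
  have empty: "{x. x \<in> pverts T \<and> F x < F a} = {}" using a(2) by force
  show ?thesis unfolding offset_def empty by simp
qed

text \<open>The offset of \<open>v\<close> contains all stretches counted for \<open>u\<close>, and
  that of \<open>u\<close> itself. The term \<open>gdiam T\<close> in \<open>stretch u\<close>
  cancels against the one in the radio condition of \<open>F\<close>.\<close>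

lemma offset_gap:
  assumes u: "u \<in> pverts T" and v: "v \<in> pverts T" and less: "F u < F v"
  shows "(2 * int k - 1) * slack u + 2 * int height + 1 - int (gdist T u v) \<le> offset v - offset u"
proof -
  let ?A = "{x. x \<in> pverts T \<and> F x < F u}" and ?B = "{x. x \<in> pverts T \<and> F x < F v}"
  have fin: "finite ?B" using T.pair_finite_verts by simp
  have "sum stretch (insert u ?A) \<le> sum stretch ?B"
    using u less by (intro sum_mono2[OF fin]) (auto simp: stretch_nonneg)
  moreover have "sum stretch (insert u ?A) = stretch u + sum stretch ?A"
    using T.pair_finite_verts by (intro sum.insert) auto
  moreover have "int (gdiam T) + 1 - int (gdist T u v) \<le> \<bar>int (F u) - int (F v)\<bar>"
  proof -
    have "u \<noteq> v" using less by auto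
    then show ?thesis using F u v unfolding radio_labeling_def by blast
  qed
  ultimately show ?thesis
    using less unfolding offset_def stretch_def[of u] by linarith
qed

text \<open>Here \<open>2 * height + 4\<close> is the diameter plus 1. Each copy of \<open>u\<close>
  still to come after \<open>p\<close> and each copy of \<open>v\<close> before \<open>q\<close>
  adds at least 1 to \<open>offset_gap\<close>.\<close>

lemma copies_gap:
  assumes p: "p \<in> P" and q: "q \<in> P" and u: "u \<in> pverts T" and v: "v \<in> pverts T" and less: "F u < F v"
  shows "2 * int height + 4 - int (tdist (Inr (p, u)) (Inr (q, v))) \<le>
    label (Inr (q, v)) - label (Inr (p, u))"
proof -
  have "(2 * int k - 1 - copy_index p) * 1 \<le> (2 * int k - 1 - copy_index p) * slack u"
    using slack_ge_1[OF u] copy_index_less[OF p] by (intro mult_left_mono) auto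
  moreover have "copy_index q * 1 \<le> copy_index q * slack v"
    using slack_ge_1[OF v] copy_index_nonneg[OF q] by (intro mult_left_mono) auto
  ultimately have diff: "2 * int k - 1 - copy_index p + copy_index q + 2 * int height + 1 - int (gdist T u v) \<le>
      label (Inr (q, v)) - label (Inr (p, u))"
    using offset_gap[OF u v less] by (simp add: algebra_simps)
  show ?thesis
  proof (cases "p = q")
    case True
    \<comment> \<open>Within one copy the distance is not lengthened by the double star, so 3
      further units are required; \<open>2 * k - 1\<close> are available.\<close>
    then show ?thesis using diff k_ge_2 by simp
  next
    case False
    \<comment> \<open>The first and the last copy lie on different sides, so the extra unit is not needed there.\<close>
    have "\<not> (copy_index p = 2 * int k - 1 \<and> copy_index q = 0)" if "side p = side q"
      using that even_copy_index_iff[OF p] even_copy_index_iff[OF q] by auto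
    then have "1 \<le> 2 * int k - 1 - copy_index p + copy_index q" if "side p = side q"
      using that copy_index_less[OF p] copy_index_nonneg[OF q] by linarith
    then show ?thesis
      using diff False gdist_le_ht[OF u v] copy_index_less[OF p] copy_index_nonneg[OF q]
      by auto
  qed
qed

text \<open>Opposite sides require exactly one \<open>slack v\<close>. The same side requires one
  unit more, but there the indices differ by at least 2 by parity, and \<open>slack v\<close> is at
  least 1.\<close>

lemma same_vertex_gap:
  assumes p: "p \<in> P" and q: "q \<in> P" and v: "v \<in> pverts T" and less: "copy_index p < copy_index q"
  shows "2 * int height + 4 - int (tdist (Inr (p, v)) (Inr (q, v))) \<le>
    label (Inr (q, v)) - label (Inr (p, v))"
proof -
  define s where "s = (if side p = side q then 2 else 1 :: int)"
  have "copy_index q \<noteq> copy_index p + 1" if "side p = side q"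
    using that even_copy_index_iff[OF p] even_copy_index_iff[OF q] by auto
  then have "s \<le> copy_index q - copy_index p"
    using less by (auto simp: s_def)
  then have "s * slack v \<le> (copy_index q - copy_index p) * slack v"
    using slack_ge_1[OF v] by (intro mult_right_mono) auto
  moreover have "p \<noteq> q" using less by auto
  ultimately show ?thesis
    using slack_ge_1[OF v] by (auto simp: s_def slack_def algebra_simps)
qed

text \<open>The condition against \<open>Hub False\<close>. For \<open>a\<close> it is tight at
  index 0, and copies on the side \<open>False\<close> have index at least 1. For any other vertex
  the whole run through the copies of \<open>a\<close> lies in between.\<close>

lemma low_hub_gap:
  assumes p: "p \<in> P" and v: "v \<in> pverts T"
  shows "2 * int height + 2 - int (ht v) + (if side p then 0 else 1) \<le> label (Inr (p, v))"
proof -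
  have index: "copy_index p * 1 \<le> copy_index p * slack v"
    using slack_ge_1[OF v] copy_index_nonneg[OF p] by (intro mult_left_mono) auto
  show ?thesis
  proof (cases "v = a")
    case True
    have "copy_index p \<noteq> 0" if "\<not> side p" using that even_copy_index_iff[OF p] by auto
    then have "(if side p then 0 else 1) \<le> copy_index p"
      using copy_index_nonneg[OF p] by (cases "side p") auto
    then have "(if side p then 0 else 1) \<le> copy_index p * slack a"
      using index unfolding True by linarith
    then show ?thesis by (simp add: True offset_a)
  next
    case False
    then have "F a < F v" using F_eq_iff[OF a(1) v] a(2)[OF v] by simp
    moreover have "3 * 1 \<le> (2 * int k - 1) * slack a"
      using k_ge_2 slack_ge_1[OF a(1)] by (intro mult_mono) auto
    ultimately have "3 + 2 * int height + 1 - int (gdist T a v) \<le> offset v"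
      using offset_gap[OF a(1) v] offset_a by linarith
    then show ?thesis
      using index copy_index_nonneg[OF p] gdist_le_ht[OF a(1) v] ht_le_height[OF a(1)] by auto
  qed
qed

lemma high_hub_gap:
  assumes p: "p \<in> P" and v: "v \<in> pverts T"
  shows "2 * int height + 2 - int (ht v) + (if side p then 1 else 0) \<le> top_label - label (Inr (p, v))"
proof -
  have index: "(2 * int k - 1 - copy_index p) * 1 \<le> (2 * int k - 1 - copy_index p) * slack v"
    using slack_ge_1[OF v] copy_index_less[OF p] by (intro mult_left_mono) auto
  show ?thesis
  proof (cases "v = z")
    case True
    \<comment> \<open>Mirror image of \<open>low_hub_gap\<close>: the last index is odd, so copies
      of \<open>z\<close> on the side of the final hub come at least one gap earlier.\<close>
    have "copy_index p \<noteq> 2 * int k - 1" if "side p" using that even_copy_index_iff[OF p] by auto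
    then have "(if side p then 1 else 0) \<le> 2 * int k - 1 - copy_index p"
      using copy_index_less[OF p] by auto
    then have "(if side p then 1 else 0) \<le> (2 * int k - 1 - copy_index p) * slack z"
      by (rule order_trans) (use index True in simp)
    then show ?thesis using True by (simp add: top_label_def algebra_simps)
  next
    case False
    then have "F v < F z" using F_eq_iff[OF v z(1)] z(2)[OF v] by simp
    then have "(2 * int k - 1) * slack v + 2 * int height + 1 - int (gdist T v z) \<le> offset z - offset v"
      by (rule offset_gap[OF v z(1)])
    moreover have "3 * 1 \<le> (2 * int k - 1) * slack z"
      using k_ge_2 slack_ge_1[OF z(1)] by (intro mult_mono) auto
    ultimately have "2 * int height + 2 - int (ht z) + (2 * int k - 1 - copy_index p) * slack v
        + 2 * int height + 4 - int (gdist T v z) \<le> top_label - label (Inr (p, v))"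
      by (simp add: top_label_def algebra_simps)
    moreover have "0 \<le> (2 * int k - 1 - copy_index p) * slack v"
      using slack_ge_1[OF v] copy_index_less[OF p] by (intro mult_nonneg_nonneg) auto
    ultimately show ?thesis
      using gdist_le_ht[OF v z(1)] ht_le_height[OF z(1)] by (cases "side p") simp_all
  qed
qed

lemma top_label_ge: "2 * int height + 4 \<le> top_label"
proof -
  have p: "Pendant True 0 \<in> P" using k_pos unfolding pendants_def by blast
  show ?thesis
    using low_hub_gap[OF p a(1)] high_hub_gap[OF p a(1)] ht_le_height[OF a(1)] by simp
qed

lemma label_bounds:
  assumes "x \<in> pverts TD"
  shows "0 \<le> label x" "label x \<le> top_label"
proof -
  have "0 \<le> label x \<and> label x \<le> top_label"
    using assms
  proof (cases rule: TD_vert_cases)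
    case (hub b)
    then show ?thesis using top_label_ge by simp
  next
    case (copy p v)
    then show ?thesis
      using low_hub_gap[of p v] high_hub_gap[of p v] ht_le_height[of v] by (auto split: if_splits)
  qed
  then show "0 \<le> label x" "label x \<le> top_label" by auto
qed

lemma hub_copy_gap:
  assumes "p \<in> P" "v \<in> pverts T"
  shows "2 * int height + 4 - int (tdist (Inl (Hub b)) (Inr (p, v))) \<le>
    \<bar>label (Inl (Hub b)) - label (Inr (p, v))\<bar>"
  using low_hub_gap[OF assms] high_hub_gap[OF assms]
  by (cases b; cases "side p") (simp_all del: label.simps(2))

lemma tdist_commute: "x \<in> pverts TD \<Longrightarrow> y \<in> pverts TD \<Longrightarrow> tdist x y = tdist y x"
  using TD.gdist_commute[of x y] by (simp add: gdist_TD)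

lemma label_gap:
  assumes x: "x \<in> pverts TD" and y: "y \<in> pverts TD" and neq: "x \<noteq> y"
  shows "2 * int height + 4 - int (tdist x y) \<le> \<bar>label x - label y\<bar>"
  using x
proof (cases rule: TD_vert_cases)
  case (hub b)
  show ?thesis
    using y
  proof (cases rule: TD_vert_cases)
    case (hub c)
    then show ?thesis using \<open>x = Inl (Hub b)\<close> neq top_label_ge by auto
  next
    case (copy p v)
    then show ?thesis using hub_copy_gap[of p v b] hub by simp
  qed
next
  case xc: (copy p u)
  show ?thesis
    using y
  proof (cases rule: TD_vert_cases)
    case (hub c)
    then show ?thesis
      using hub_copy_gap[of p u c] xc tdist_commute[OF x y] by (simp add: abs_minus_commute)
  next
    case yc: (copy q v)
    consider "F u < F v" | "F v < F u" | "u = v" "copy_index p < copy_index q"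
      | "u = v" "copy_index q < copy_index p"
      using F_eq_iff[OF xc(3) yc(3)] copy_index_inj[OF xc(2) yc(2)] neq xc(1) yc(1)
      by (metis linorder_neqE)
    then show ?thesis
    proof cases
      case 1
      have "2 * int height + 4 - int (tdist x y) \<le> label y - label x"
        unfolding xc(1) yc(1) by (rule copies_gap) fact+
      then show ?thesis by linarith
    next
      case 2
      have "2 * int height + 4 - int (tdist y x) \<le> label x - label y"
        unfolding xc(1) yc(1) by (rule copies_gap) fact+
      then show ?thesis using tdist_commute[OF x y] by linarith
    next
      case 3
      have "2 * int height + 4 - int (tdist x y) \<le> label y - label x"
        unfolding xc(1) yc(1) \<open>u = v\<close> by (rule same_vertex_gap) fact+
      then show ?thesis by linarith
    next
      case 4
      have "2 * int height + 4 - int (tdist y x) \<le> label x - label y"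
        unfolding xc(1) yc(1) \<open>u = v\<close> by (rule same_vertex_gap) fact+
      then show ?thesis using tdist_commute[OF x y] by linarith
    qed
  qed
qed

lemma radio_labeling_label: "radio_labeling TD (\<lambda>x. nat (label x))"
  unfolding radio_labeling_def
proof (intro ballI impI)
  fix x y assume xy: "x \<in> pverts TD" "y \<in> pverts TD" "x \<noteq> y"
  show "int (gdiam TD) + 1 - int (gdist TD x y) \<le> \<bar>int (nat (label x)) - int (nat (label y))\<bar>"
    using label_gap[OF xy] label_bounds(1)[OF xy(1)] label_bounds(1)[OF xy(2)]
    by (simp add: gdiam_TD gdist_TD[OF xy(1,2)])
qed

lemma span_label_le: "int (label_span TD (\<lambda>x. nat (label x))) \<le> top_label"
proof -
  have "pverts TD \<noteq> {}" using hub_in_TD[of True] by blast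
  then have "label_span TD (\<lambda>x. nat (label x)) \<le> nat top_label"
    unfolding label_span_def using TD.pair_finite_verts label_bounds(2)
    by (subst Max_le_iff) (auto intro: nat_mono)
  then show ?thesis using top_label_ge by linarith
qed

lemma top_label_eq:
  "top_label = 4 * int height + 4 - int (ht a) - int (ht z)
    + (int (card (pverts T)) - 1) * (2 * int height - int (gdiam T))
    + (2 * int k - 1) * (int (card (pverts T)) * (2 * int height + 1) - 2 * int total_height)
    + (int (F z) - int (F a))"
proof -
  have "{x. x \<in> pverts T \<and> F x < F z} = pverts T - {z}"
    using z F_eq_iff[of _ z] by (auto simp: less_le)
  \<comment> \<open>Adding \<open>stretch z\<close> completes the sum to all of \<open>T\<close>.
    Since \<open>top_label\<close> contains only the slack part of \<open>stretch z\<close>, the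
    surplus occurs \<open>card (pverts T) - 1\<close> times.\<close>
  then have "offset z + stretch z = sum stretch (pverts T) + (int (F z) - int (F a))"
    by (simp add: offset_def sum.remove[OF T.pair_finite_verts z(1), of stretch])
  also have "sum stretch (pverts T) =
      (2 * int k - 1) * sum slack (pverts T) + int (card (pverts T)) * (2 * int height - int (gdiam T))"
    by (simp add: stretch_def sum.distrib sum_distrib_left)
  also have "sum slack (pverts T) = int (card (pverts T)) * (2 * int height + 1) - 2 * int total_height"
    by (simp add: slack_def sum_subtractf sum_distrib_left total_height_def)
  finally show ?thesis
    unfolding top_label_def stretch_def[of z] by (simp add: algebra_simps)
qed

end

context grafted_double_star
begin

lemma lb_T:
  assumes "weight_centers T = {w}"
  shows "lb T = (int (card (pverts T)) - 1) * (int (gdiam T) + 1) - 2 * int total_height + 1"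
proof -
  have "level T u = ht u" for u by (simp add: level_def assms)
  then show ?thesis
    by (simp add: lb_def center_eps_def assms total_level_def total_height_def)
qed

lemma radio_number_TD:
  assumes "lower_bound_tree T" and wc: "weight_centers T = {w}" and k: "2 \<le> k"
  shows "int (radio_number TD) = lb TD"
proof (rule antisym)
  have w: "w \<in> weight_centers T" using wc by simp
  obtain F where opt: "radio_labeling T F" "label_span T F = radio_number T"
    using T.ex_optimal_radio_labeling by blast
  have fin: "finite (F ` pverts T)" "F ` pverts T \<noteq> {}"
    using T.pair_finite_verts w_in by auto
  obtain a where a_arg: "a \<in> pverts T" "F a = Min (F ` pverts T)"
    using Min_in[OF fin] by (elim imageE) simp
  obtain z where z_arg: "z \<in> pverts T" "F z = Max (F ` pverts T)"
    using Max_in[OF fin] by (elim imageE) simp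
  have a_min: "F a \<le> F v" and z_max: "F v \<le> F z" if "v \<in> pverts T" for v
    using that fin(1) a_arg(2) z_arg(2) by simp_all
  interpret grafted_labeling T w k F a z
    by unfold_locales (fact opt k a_arg z_arg a_min z_max)+
  \<comment> \<open>The diameter is at least 2, so \<open>T\<close> has more than one vertex. As
    only one of \<open>a\<close> and \<open>z\<close> can be the root, their heights add up to at
    least 1, exactly the unit that the comparison with \<open>lb TD\<close> needs.\<close>
  have "a \<noteq> z"
  proof
    assume "a = z"
    then have "F v = F a" if "v \<in> pverts T" for v
      using a_min[OF that] z_max[OF that] by simp
    then have "v = a" if "v \<in> pverts T" for v
      using F_eq_iff[OF that a(1)] that by blast
    then have "gdist T u v = 0" if "u \<in> pverts T" "v \<in> pverts T" for u v
      using that T.gdist_self by metis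
    then have "gdiam T = 0" using a(1) by (intro T.gdiam_eqI[of 0 a a]) simp_all
    then show False using assms(1) by (simp add: lower_bound_tree_def)
  qed
  then have "ht a \<noteq> 0 \<or> ht z \<noteq> 0"
    using T.gdist_eq_0_iff[OF a(1) w_in] T.gdist_eq_0_iff[OF z(1) w_in] by auto
  then have "1 \<le> int (ht a) + int (ht z)" by linarith
  moreover have "int (F z) = lb T"
    using z_arg(2) opt(2) assms(1) by (simp add: label_span_def lower_bound_tree_def)
  \<comment> \<open>Inserting \<open>lb T\<close> for \<open>F z\<close> cancels all terms in
    \<open>gdiam T\<close>.\<close>
  ultimately have "top_label \<le> lb TD"
    unfolding top_label_eq lb_T[OF wc] lb_TD_eq[OF w] by (simp add: algebra_simps)
  then show "int (radio_number TD) \<le> lb TD"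
    using radio_number_le[OF radio_labeling_label] span_label_le by linarith
  obtain f where "radio_labeling TD f" "label_span TD f = radio_number TD"
    using TD.ex_optimal_radio_labeling by blast
  then show "lb TD \<le> int (radio_number TD)" using lb_TD_le_span[OF w, of f] by simp
qed

end

theorem theorem3p4:
  fixes T :: "'a pair_pre_digraph" and w0 :: 'a and k n0 d0 d :: nat
    and TD :: "(dstar_vertex + dstar_vertex \<times> 'a) pair_pre_digraph"
  assumes "lower_bound_tree T"
    and "n0 = card (pverts T)"
    and "d0 = gdiam T"
    and "weight_centers T = {w0}"
    and "k \<ge> 2"
    and "TD = attach_at_leaves (double_star k) T w0"
    and "d = gdiam TD"
  shows "lower_bound_tree TD \<and>
    int (radio_number TD) =
      2 * int k * (int (radio_number T) + int n0 * (int d - int d0 - 3) + int d0) + int d"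
proof -
  have tree: "utree T" and rn: "int (radio_number T) = lb T"
    using assms(1) by (auto simp: lower_bound_tree_def)
  then interpret T: pair_graph T by (simp add: utree_def)
  have "w0 \<in> weight_centers T" using assms(4) by simp
  then have w0: "w0 \<in> pverts T" by (simp add: weight_centers_def)
  interpret G: grafted_double_star T w0 k
    using tree w0 assms(5) by unfold_locales (auto simp: utree_def)
  have eq: "int (radio_number TD) = lb TD"
    unfolding assms(6) by (rule G.radio_number_TD[OF assms(1,4,5)])
  have d: "d = 2 * G.height + 3"
    using G.gdiam_TD unfolding assms(6,7) .
  have "utree TD" unfolding assms(6) by (rule G.utree_TD[OF tree])
  \<comment> \<open>The total height is expressed through \<open>radio_number T = lb T\<close>, and
    the height through \<open>d\<close>.\<close>
  moreover have "lb TD =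
      2 * int k * (int (radio_number T) + int n0 * (int d - int d0 - 3) + int d0) + int d"
    unfolding rn d G.lb_T[OF assms(4)] assms(2,3)
    unfolding assms(6) G.lb_TD_eq[OF \<open>w0 \<in> weight_centers T\<close>]
    by (simp add: algebra_simps)
  ultimately show ?thesis
    using eq d assms(7) by (simp add: lower_bound_tree_def)
qed

end
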